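(* Consider the Lambek calculus allowing empty antecedents (connectives $\cdot,\backslash,/$) extended with one unary connective ${!}$ governed by the rules $({!}\to)$, $(\to{!})$ and the local contraction rule $(\mathrm{contr})$, and optionally also the rule $(\mathrm{weak})$. For each of these two systems (with or without $(\mathrm{weak})$), the cut rule is not admissible: there is a sequent derivable in the system extended with $(\mathrm{cut})$ that is not derivable in the system without $(\mathrm{cut})$.
   Context: Formulae are built from variables using $\cdot$, $\backslash$, $/$ and unary ${!}$. Sequents are $\Gamma\to C$ with $\Gamma$ a finite, possibly empty, sequence of formulae. The Lambek calculus allowing empty antecedents has the axiom $A\to A$ and the rules (premises / conclusion): $\Gamma_1,A,B,\Gamma_2\to C\ /\ \Gamma_1,A\cdot B,\Gamma_2\to C$; $\Gamma_1\to A$, $\Gamma_2\to B\ /\ \Gamma_1,\Gamma_2\to A\cdot B$; $\Pi\to A$, $\Gamma_1,B,\Gamma_2\to C\ /\ \Gamma_1,\Pi,A\backslash B,\Gamma_2\to C$; $A,\Pi\to B\ /\ \Pi\to A\backslash B$; $\Pi\to A$, $\Gamma_1,B,\Gamma_2\to C\ /\ \Gamma_1,B/A,\Pi,\Gamma_2\to C$; $\Pi,A\to B\ /\ \Pi\to B/A$. The modal rules are: $({!}\to)$ $\Gamma_1,A,\Gamma_2\to C\ /\ \Gamma_1,{!}A,\Gamma_2\to C$; $(\to{!})$ ${!}A_1,\dots,{!}A_n\to B\ /\ {!}A_1,\dots,{!}A_n\to{!}B$; $(\mathrm{contr})$ (local contraction) $\Gamma_1,{!}A,{!}A,\Gamma_2\to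 C\ /\ \Gamma_1,{!}A,\Gamma_2\to C$; $(\mathrm{weak})$ $\Gamma_1,\Gamma_2\to C\ /\ \Gamma_1,{!}A,\Gamma_2\to C$. The cut rule: $\Pi\to A$, $\Gamma_1,A,\Gamma_2\to C\ /\ \Gamma_1,\Pi,\Gamma_2\to C$. *)

theory Defs
  imports Main
begin

datatype formula =
    Var nat
  | Prod formula formula
  | Under formula formula  \<comment> \<open>\<open>Under A B\<close>: argument \<open>A\<close> on the left, value \<open>B\<close>\<close>
  | Over formula formula   \<comment> \<open>\<open>Over B A\<close> is \<open>B / A\<close>: value \<open>B\<close>, argument \<open>A\<close> on the right\<close>
  | Bang formula

text \<open>
  \<open>derivable w c \<Gamma> C\<close>: the sequent \<open>\<Gamma> \<rightarrow> C\<close> is derivable in the calculus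
  with (weak) iff \<open>w\<close> and with (cut) iff \<open>c\<close>. Antecedents may be empty; in particular
  \<open>bang_right\<close> includes the case of no formulae on the left.
\<close>

inductive derivable :: "bool \<Rightarrow> bool \<Rightarrow> formula list \<Rightarrow> formula \<Rightarrow> bool"
  for w c :: bool
where
  ax: "derivable w c [A] A"
| prod_left: "derivable w c (\<Gamma>1 @ [A, B] @ \<Gamma>2) C \<Longrightarrow>
    derivable w c (\<Gamma>1 @ [Prod A B] @ \<Gamma>2) C"
| prod_right: "derivable w c \<Gamma>1 A \<Longrightarrow> derivable w c \<Gamma>2 B \<Longrightarrow>
    derivable w c (\<Gamma>1 @ \<Gamma>2) (Prod A B)"
| under_left: "derivable w c \<Pi> A \<Longrightarrow> derivable w c (\<Gamma>1 @ [B] @ \<Gamma>2) C \<Longrightarrow>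
    derivable w c (\<Gamma>1 @ \<Pi> @ [Under A B] @ \<Gamma>2) C"
| under_right: "derivable w c ([A] @ \<Pi>) B \<Longrightarrow> derivable w c \<Pi> (Under A B)"
| over_left: "derivable w c \<Pi> A \<Longrightarrow> derivable w c (\<Gamma>1 @ [B] @ \<Gamma>2) C \<Longrightarrow>
    derivable w c (\<Gamma>1 @ [Over B A] @ \<Pi> @ \<Gamma>2) C"
| over_right: "derivable w c (\<Pi> @ [A]) B \<Longrightarrow> derivable w c \<Pi> (Over B A)"
| bang_left: "derivable w c (\<Gamma>1 @ [A] @ \<Gamma>2) C \<Longrightarrow>
    derivable w c (\<Gamma>1 @ [Bang A] @ \<Gamma>2) C"
| bang_right: "derivable w c (map Bang As) B \<Longrightarrow> derivable w c (map Bang As) (Bang B)"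
| contr: "derivable w c (\<Gamma>1 @ [Bang A, Bang A] @ \<Gamma>2) C \<Longrightarrow>
    derivable w c (\<Gamma>1 @ [Bang A] @ \<Gamma>2) C"
| weak: "w \<Longrightarrow> derivable w c (\<Gamma>1 @ \<Gamma>2) C \<Longrightarrow>
    derivable w c (\<Gamma>1 @ [Bang A] @ \<Gamma>2) C"
| cut: "c \<Longrightarrow> derivable w c \<Pi> A \<Longrightarrow> derivable w c (\<Gamma>1 @ [A] @ \<Gamma>2) C \<Longrightarrow>
    derivable w c (\<Gamma>1 @ \<Pi> @ \<Gamma>2) C"

end

theory Submission
  imports Defs
begin

text \<open>
  From \<open>!p, !q \<rightarrow> !(p \<cdot> q)\<close> and \<open>!(p \<cdot> q) \<rightarrow> (p \<cdot> q) \<cdot> (p \<cdot> q)\<close>, where the second uses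
  contraction, cut yields \<open>!p, !q \<rightarrow> (p \<cdot> q) \<cdot> (p \<cdot> q)\<close>. Without cut, local contraction can only
  duplicate \<open>!p\<close> and \<open>!q\<close> in place, so in every antecedent of a derivation all \<open>p\<close>s precede all
  \<open>q\<close>s, whereas the succedent needs a \<open>q\<close> before a \<open>p\<close>.
\<close>

abbreviation pq :: formula where
  "pq \<equiv> Prod (Var 0) (Var 1)"

lemma derivable_bang_pair: "derivable w c [Bang A, Bang B] (Bang (Prod A B))"
proof -
  have "derivable w c [Bang X] X" for X
    using bang_left[of w c "[]" X "[]" X] by (simp add: ax)
  from prod_right[OF this[of A] this[of B]]
  have "derivable w c (map Bang [A, B]) (Prod A B)"
    by simp
  from bang_right[OF this] show ?thesis
    by simp
qed

lemma derivable_bang_double: "derivable w c [Bang A] (Prod A A)"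
proof -
  have "derivable w c [A, A] (Prod A A)"
    using prod_right[OF ax ax, of w c A A] by simp
  then have "derivable w c [Bang A, A] (Prod A A)"
    using bang_left[of w c "[]" A "[A]"] by simp
  then have "derivable w c [Bang A, Bang A] (Prod A A)"
    using bang_left[of w c "[Bang A]" A "[]"] by simp
  then show ?thesis
    using contr[of w c "[]" A "[]"] by simp
qed

text \<open>Ignoring bangs makes \<open>bang_left\<close> preserve letters; the default 0 is never
  reached on the antecedents below.\<close>

fun letter :: "formula \<Rightarrow> nat" where
  "letter (Bang A) = letter A"
| "letter (Var n) = n"
| "letter _ = 0"

text \<open>The first two conjuncts strengthen the induction for \<open>prod_right\<close>:
  variables feed \<open>pq\<close>, which feeds \<open>Prod pq pq\<close>. Read upwards, contraction
  keeps the order and weakening only drops letters.\<close>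

lemma cut_free_sorted_antecedent:
  assumes "derivable w False \<Gamma> C"
    and "set \<Gamma> \<subseteq> range Var \<union> Bang ` range Var"
    and "sorted (map letter \<Gamma>)"
  shows "(\<forall>n. C = Var n \<longrightarrow> n \<in> letter ` set \<Gamma>) \<and>
    (C = pq \<longrightarrow> {0, 1} \<subseteq> letter ` set \<Gamma>) \<and> C \<noteq> Prod pq pq"
  using assms
proof (induction rule: derivable.induct)
  case (prod_right \<Gamma>1 A \<Gamma>2 B)
  have le: "x \<le> y" if "x \<in> letter ` set \<Gamma>1" "y \<in> letter ` set \<Gamma>2" for x y
    using prod_right.prems(2) that by (auto simp: sorted_append)
  have IH1: "(\<forall>n. A = Var n \<longrightarrow> n \<in> letter ` set \<Gamma>1) \<and> (A = pq \<longrightarrow> {0, 1} \<subseteq> letter ` set \<Gamma>1)"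
    using prod_right.IH(1) prod_right.prems by (simp add: sorted_append)
  have IH2: "(\<forall>n. B = Var n \<longrightarrow> n \<in> letter ` set \<Gamma>2) \<and> (B = pq \<longrightarrow> {0, 1} \<subseteq> letter ` set \<Gamma>2)"
    using prod_right.IH(2) prod_right.prems by (simp add: sorted_append)
  \<comment> \<open>Otherwise letter 1 occurs in \<open>\<Gamma>1\<close> and 0 in
    \<open>\<Gamma>2\<close>, against sortedness.\<close>
  have "\<not> (A = pq \<and> B = pq)"
    using IH1 IH2 le[of 1 0] by auto
  with IH1 IH2 show ?case
    by (simp add: image_Un)
next
  case (bang_left \<Gamma>1 A \<Gamma>2 C)
  then have "A \<in> range Var"
    by auto
  with bang_left show ?case
    by auto
qed (auto simp: sorted_append)

theorem theorem3:
  fixes w :: bool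
  shows "\<exists>\<Gamma> C. derivable w True \<Gamma> C \<and> \<not> derivable w False \<Gamma> C"
proof (intro exI conjI)
  show "derivable w True [Bang (Var 0), Bang (Var 1)] (Prod pq pq)"
    using cut[of True w "[Bang (Var 0), Bang (Var 1)]" "Bang pq" "[]" "[]"]
      derivable_bang_pair derivable_bang_double by simp
  show "\<not> derivable w False [Bang (Var 0), Bang (Var 1)] (Prod pq pq)"
    using cut_free_sorted_antecedent[of w "[Bang (Var 0), Bang (Var 1)]"] by fastforce
qed

end
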